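(* Let $k$ be a positive integer with $k \equiv 12 \pmod{15}$ and let \[ n = L_{CC}(10,k) = \frac{512k^5+1280k^4+6080k^3+7840k^2+10010k+3741}{3125}. \] Then there is an undirected Cayley graph of the cyclic group $\mathbb{Z}_n$ on five generators which has diameter $k$. Moreover, a generating set for such a graph is \[ \Big\{1,\ \tfrac{128k^4+256k^3+1192k^2+1064k+883}{625},\ \tfrac{512k^5+1920k^4+6560k^3+14600k^2+7980k+10431}{9375},\ \tfrac{512k^5+1920k^4+6560k^3+14600k^2+15480k+14181}{9375},\ \tfrac{512k^5+1920k^4+8960k^3+18200k^2+28530k+20106}{9375}\Big\}, \] i.e. the Cayley graph of $\mathbb{Z}_n$ with connection set $\{\pm g_1,\dots,\pm g_5\}$, where $g_1,\dots,g_5$ are these integers taken modulo $n$, has diameter $k$.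
   Context: For a positive integer $n$ and integers $g_1,\dots,g_5$, the undirected Cayley (circulant) graph of the cyclic group $\mathbb{Z}_n$ with generating set $\{g_1,\dots,g_5\}$ has vertex set $\mathbb{Z}_n$, with $i$ and $j$ adjacent if and only if $j-i \equiv \pm g_t \pmod n$ for some $t$. Its diameter is the maximum over pairs of vertices of the graph distance. The notation $L_{CC}(10,k)$ is just a name for the displayed polynomial value. *)

theory Defs
  imports "Graph_Theory.Graph_Theory" "HOL-Number_Theory.Cong"
begin

text \<open>
  As usual in \<^theory>\<open>Graph_Theory.Digraph\<close>, an undirected graph is a symmetric digraph.
  The vertex set of the circulant graph consists of the canonical representatives of the
  residue classes modulo \<open>n\<close>; the generators may be arbitrary integer representatives.
\<close>

definition circulant_graph :: "nat \<Rightarrow> int set \<Rightarrow> int pair_pre_digraph" where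
  "circulant_graph n S =
    \<lparr> pverts = {0..<int n},
      parcs = {(i, j). i \<in> {0..<int n} \<and> j \<in> {0..<int n} \<and>
        (\<exists>g\<in>S. [j - i = g] (mod int n) \<or> [j - i = - g] (mod int n))} \<rparr>"

lemma pair_wf_digraph_circulant_graph: "pair_wf_digraph (circulant_graph n S)"
  by unfold_locales (auto simp: circulant_graph_def)

lemma symmetric_circulant_graph: "symmetric (with_proj (circulant_graph n S))"
proof -
  have "[i - j = - g] (mod int n)" if "[j - i = g] (mod int n)" for i j g :: int
    using that cong_minus_minus_iff[of "j - i" g "int n"] by simp
  moreover have "[i - j = g] (mod int n)" if "[j - i = - g] (mod int n)" for i j g :: int
    using that cong_minus_minus_iff[of "j - i" "- g" "int n"] by simp
  ultimately show ?thesis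
    unfolding symmetric_def sym_def by (fastforce simp: circulant_graph_def)
qed

text \<open>
  The distance is the minimal cost of a walk, with every arc of cost 1; it is \<open>\<infinity>\<close> if there is
  no walk. Hence the diameter of a disconnected graph is \<open>\<infinity>\<close>.
\<close>

definition graph_distance :: "('a, 'b) pre_digraph \<Rightarrow> 'a \<Rightarrow> 'a \<Rightarrow> ereal" where
  "graph_distance G u v = wf_digraph.\<mu> G (\<lambda>_. 1) u v"

definition graph_diameter :: "('a, 'b) pre_digraph \<Rightarrow> ereal" where
  "graph_diameter G = (SUP (u, v)\<in>verts G \<times> verts G. graph_distance G u v)"

text \<open>
  The fractions are taken in the rationals; that their values are integers for
  \<open>k \<equiv> 12 (mod 15)\<close> is part of what is to be shown.
\<close>

definition L_CC_10 :: "nat \<Rightarrow> rat" where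
  "L_CC_10 k = (512 * of_nat k ^ 5 + 1280 * of_nat k ^ 4 + 6080 * of_nat k ^ 3
    + 7840 * of_nat k ^ 2 + 10010 * of_nat k + 3741) / 3125"

definition generators_10 :: "nat \<Rightarrow> rat set" where
  "generators_10 k =
    {1,
     (128 * of_nat k ^ 4 + 256 * of_nat k ^ 3 + 1192 * of_nat k ^ 2
       + 1064 * of_nat k + 883) / 625,
     (512 * of_nat k ^ 5 + 1920 * of_nat k ^ 4 + 6560 * of_nat k ^ 3
       + 14600 * of_nat k ^ 2 + 7980 * of_nat k + 10431) / 9375,
     (512 * of_nat k ^ 5 + 1920 * of_nat k ^ 4 + 6560 * of_nat k ^ 3
       + 14600 * of_nat k ^ 2 + 15480 * of_nat k + 14181) / 9375,
     (512 * of_nat k ^ 5 + 1920 * of_nat k ^ 4 + 8960 * of_nat k ^ 3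
       + 18200 * of_nat k ^ 2 + 28530 * of_nat k + 20106) / 9375}"

end

theory Submission
  imports Defs
begin

text \<open>
  Put \<open>k = 15 m + 12\<close> and \<open>b = (2 k + 1) / 5 = 6 m + 5\<close>. The kernel of
  \<open>x \<mapsto> \<Sum> g\<^sub>i x\<^sub>i\<close> from \<open>\<int>\<^sup>5\<close> to \<open>\<int>\<^sub>n\<close> is the lattice
  of all \<open>(2 b I + A)\<^sup>T c / 2\<close> where the entries of \<open>c\<close> have the same parity and \<open>A\<close> is a
  skew-symmetric sign matrix supported on the bowtie graph, two triangles sharing a hub. For a sign
  vector \<open>s\<close> the lattice vector \<open>v\<^sub>s = (2 b I + A)\<^sup>T s / 2\<close> has 1-norm \<open>5 b = 2 k + 1\<close>, as
  \<open>s\<^sup>T A s = 0\<close>.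

  Upper bound: let \<open>r\<close> be of least norm in its class modulo the sublattice given by even \<open>c\<close>. If
  \<open>r\<close> has sign vector \<open>s\<close> and no zero entry, subtracting \<open>\<plusminus>\<close> the i-th generator of the sublattice
  shortens \<open>r\<close> exactly when \<open>\<bar>r\<^sub>i\<bar> > \<bar>(v\<^sub>s)\<^sub>i\<bar>\<close>. Hence \<open>r\<close> lies in the box spanned by \<open>0\<close>
  and \<open>v\<^sub>s\<close>, so \<open>\<parallel>r\<parallel> + \<parallel>v\<^sub>s - r\<parallel> = 2 k + 1\<close> and one of the two norms is at most \<open>k\<close>. For zero
  entries of \<open>r\<close> the signs can be chosen so that this still holds; a conflict between two such
  choices would be a combined move that shortens \<open>r\<close>.

  Lower bound: lattice vectors with odd \<open>c\<close> have norm at least \<open>2 k + 1\<close>. Take \<open>x\<close> with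
  \<open>\<parallel>x\<parallel> = k\<close> and \<open>\<parallel>x - (b, b, b, b, b)\<parallel> = k + 1\<close>. Any \<open>y\<close> in the class of \<open>x\<close> differs by an odd
  lattice vector from one of these two, hence has norm at least \<open>k\<close>.
\<close>

section \<open>Distances in circulant graphs\<close>

text \<open>Signed counts of the uses of each generator give \<open>y\<close>. The norm is only
  bounded by the length, since steps along \<open>g\<close> and back cancel.\<close>

lemma circulant_walk_imp_combination:
  assumes S: "finite S"
    and "pre_digraph.awalk (with_proj (circulant_graph n S)) u p v"
  shows "\<exists>y. (\<Sum>g\<in>S. \<bar>y g\<bar>) \<le> int (length p) \<and> [v - u = (\<Sum>g\<in>S. y g * g)] (mod int n)"
  using assms(2)
proof (induction p arbitrary: u)
  interpret pair_wf_digraph "circulant_graph n S" by (rule pair_wf_digraph_circulant_graph)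
  {
    case Nil
    then show ?case by (intro exI[of _ "\<lambda>_. 0"]) (auto simp: awalk_Nil_iff)
  next
    case (Cons e p)
    obtain w where e: "e = (u, w)" and arc: "(u, w) \<in> parcs (circulant_graph n S)" and p: "awalk w p v"
      using Cons.prems by (cases e) (auto simp: awalk_Cons_iff)
    obtain y where y: "(\<Sum>g\<in>S. \<bar>y g\<bar>) \<le> int (length p)"
      "[v - w = (\<Sum>g\<in>S. y g * g)] (mod int n)"
      using Cons.IH[OF p] by blast
    obtain g \<epsilon> where g: "g \<in> S" and \<epsilon>: "\<bar>\<epsilon>\<bar> = 1" "[w - u = \<epsilon> * g] (mod int n)"
    proof -
      from arc obtain g where "g \<in> S" "[w - u = g] (mod int n) \<or> [w - u = - g] (mod int n)"
        by (auto simp: circulant_graph_def)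
      then show thesis using that[of g 1] that[of g "- 1"] by auto
    qed
    define z where "z = y(g := y g + \<epsilon>)"
    have "(\<Sum>i\<in>S. \<bar>z i\<bar>) \<le> (\<Sum>i\<in>S. \<bar>y i\<bar> + (if i = g then 1 else 0))"
      using \<epsilon> by (intro sum_mono) (auto simp: z_def)
    also have "\<dots> = (\<Sum>i\<in>S. \<bar>y i\<bar>) + 1" using g S by (simp add: sum.distrib)
    finally have "(\<Sum>i\<in>S. \<bar>z i\<bar>) \<le> int (length (e # p))" using y(1) by simp
    moreover have "(\<Sum>i\<in>S. z i * i) = (\<Sum>i\<in>S. y i * i + (if i = g then \<epsilon> * g else 0))"
      by (intro sum.cong) (auto simp: z_def algebra_simps)
    then have "(\<Sum>i\<in>S. z i * i) = (\<Sum>i\<in>S. y i * i) + \<epsilon> * g" using g S by (simp add: sum.distrib)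
    then have "[v - u = (\<Sum>i\<in>S. z i * i)] (mod int n)"
      using cong_add[OF y(2) \<epsilon>(2)] by simp
    ultimately show ?case by blast
  }
qed

text \<open>The walk starts along any generator with nonzero coefficient, in the direction of its
  sign; this lowers the 1-norm by exactly 1, which drives the induction.\<close>

lemma circulant_combination_imp_walk:
  assumes S: "finite S" and n: "n > 0" and "u \<in> {0..<int n}" and v: "v \<in> {0..<int n}"
    and "[v - u = (\<Sum>g\<in>S. y g * g)] (mod int n)"
  shows "\<exists>p. pre_digraph.awalk (with_proj (circulant_graph n S)) u p v
    \<and> int (length p) = (\<Sum>g\<in>S. \<bar>y g\<bar>)"
  using assms(3,5)
proof (induction "nat (\<Sum>g\<in>S. \<bar>y g\<bar>)" arbitrary: u y)
  interpret pair_wf_digraph "circulant_graph n S" by (rule pair_wf_digraph_circulant_graph)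
  {
    case 0
    have "0 \<le> (\<Sum>g\<in>S. \<bar>y g\<bar>)" by (simp add: sum_nonneg)
    then have "(\<Sum>g\<in>S. \<bar>y g\<bar>) = 0" using 0(1) by linarith
    then have y0: "\<forall>g\<in>S. y g = 0" using S by (simp add: sum_nonneg_eq_0_iff)
    then have "[v - u = 0] (mod int n)" using 0(3) by (simp add: sum.neutral)
    then have "v = u" using 0(2) v
      by (metis atLeastLessThan_iff cong_diff_iff_cong_0 cong_less_imp_eq_int)
    moreover have "u \<in> pverts (circulant_graph n S)" using 0(2) by (simp add: circulant_graph_def)
    ultimately show ?case using y0 by (intro exI[of _ "[]"]) (auto simp: awalk_Nil_iff)
  next
    case (Suc N)
    have "(\<Sum>g\<in>S. \<bar>y g\<bar>) \<noteq> 0" using Suc(2) by auto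
    then obtain g where g: "g \<in> S" "y g \<noteq> 0" by (metis abs_zero sum.neutral)
    define w where "w = (u + sgn (y g) * g) mod int n"
    define z where "z = y(g := y g - sgn (y g))"
    have "(\<Sum>i\<in>S. \<bar>y i\<bar>) = (\<Sum>i\<in>S. \<bar>z i\<bar> + (if i = g then 1 else 0))"
      using g by (intro sum.cong) (auto simp: z_def sgn_if)
    then have norm: "(\<Sum>i\<in>S. \<bar>y i\<bar>) = (\<Sum>i\<in>S. \<bar>z i\<bar>) + 1" using g S by (simp add: sum.distrib)
    have "(\<Sum>i\<in>S. y i * i) = (\<Sum>i\<in>S. z i * i + (if i = g then sgn (y g) * g else 0))"
      by (intro sum.cong) (auto simp: z_def algebra_simps)
    then have sum: "(\<Sum>i\<in>S. y i * i) = (\<Sum>i\<in>S. z i * i) + sgn (y g) * g"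
      using g S by (simp add: sum.distrib)
    have w: "w \<in> {0..<int n}" using n by (simp add: w_def)
    have wu: "[w - u = sgn (y g) * g] (mod int n)"
      by (simp add: w_def cong_def mod_diff_left_eq)
    then have vw: "[v - w = (\<Sum>i\<in>S. z i * i)] (mod int n)"
      using cong_diff[OF Suc(4) wu] sum by simp
    have "N = nat (\<Sum>i\<in>S. \<bar>z i\<bar>)" using Suc(2) norm by linarith
    then obtain p where p: "awalk w p v" "int (length p) = (\<Sum>i\<in>S. \<bar>z i\<bar>)"
      using Suc(1)[OF _ w vw] by auto
    have "(u, w) \<in> parcs (circulant_graph n S)"
      using wu w Suc(3) g by (auto simp: circulant_graph_def sgn_if split: if_splits)
    then have "awalk u ((u, w) # p) v" using p by (auto simp: awalk_Cons_iff)
    then show ?case using p norm by (intro exI[of _ "(u, w) # p"]) auto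
  }
qed

lemma graph_distance_eq_INF_length:
  "graph_distance (with_proj (circulant_graph n S)) u v =
    (INF p\<in>{p. pre_digraph.awalk (with_proj (circulant_graph n S)) u p v}. ereal (real (length p)))"
proof -
  interpret pair_wf_digraph "circulant_graph n S" by (rule pair_wf_digraph_circulant_graph)
  have "awalk_cost (\<lambda>_. 1) p = real (length p)" for p
    by (induction p) auto
  then show ?thesis by (simp add: graph_distance_def \<mu>_def)
qed

text \<open>Distances depend only on the difference of the vertices modulo \<open>n\<close>, so the
  diameter amounts to the 1-norm covering radius of the kernel lattice: \<open>upper\<close> covers
  every class, \<open>lower\<close> exhibits one remote class \<open>x\<close>.\<close>

lemma graph_diameter_circulant_eqI:
  assumes S: "finite S" and n: "n > 0"
    and upper: "\<And>x. \<exists>y. (\<Sum>g\<in>S. \<bar>y g\<bar>) \<le> int k \<and> [x = (\<Sum>g\<in>S. y g * g)] (mod int n)"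
    and lower: "\<And>y. [x = (\<Sum>g\<in>S. y g * g)] (mod int n) \<Longrightarrow> int k \<le> (\<Sum>g\<in>S. \<bar>y g\<bar>)"
  shows "graph_diameter (with_proj (circulant_graph n S)) = ereal (real k)"
  unfolding graph_diameter_def
proof (rule antisym)
  have verts: "verts (with_proj (circulant_graph n S)) = {0..<int n}"
    by (simp add: circulant_graph_def)
  let ?d = "graph_distance (with_proj (circulant_graph n S))"
  let ?V = "verts (with_proj (circulant_graph n S))"
  have "?d u v \<le> ereal (real k)" if uv: "u \<in> ?V" "v \<in> ?V" for u v
  proof -
    obtain y where y: "(\<Sum>g\<in>S. \<bar>y g\<bar>) \<le> int k" "[v - u = (\<Sum>g\<in>S. y g * g)] (mod int n)"
      using upper by blast
    obtain p where p: "pre_digraph.awalk (with_proj (circulant_graph n S)) u p v"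
      "int (length p) = (\<Sum>g\<in>S. \<bar>y g\<bar>)"
      using circulant_combination_imp_walk[OF S n _ _ y(2)] uv unfolding verts by blast
    then have "ereal (real (length p)) \<le> ereal (real k)" using y(1) by simp
    then show ?thesis unfolding graph_distance_eq_INF_length
      using p(1) by (blast intro: INF_lower2)
  qed
  then show "(SUP (u, v)\<in>?V \<times> ?V. ?d u v) \<le> ereal (real k)" by (auto intro!: SUP_least)
  have "ereal (real k) \<le> ?d 0 (x mod int n)"
    unfolding graph_distance_eq_INF_length
  proof (rule INF_greatest, clarify)
    fix p assume "pre_digraph.awalk (with_proj (circulant_graph n S)) 0 p (x mod int n)"
    then obtain y where y: "(\<Sum>g\<in>S. \<bar>y g\<bar>) \<le> int (length p)"
      "[x mod int n - 0 = (\<Sum>g\<in>S. y g * g)] (mod int n)"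
      using circulant_walk_imp_combination[OF S] by blast
    then have "int k \<le> int (length p)" using lower[of y] by (simp add: cong_def)
    then show "ereal (real k) \<le> ereal (real (length p))" by simp
  qed
  then show "ereal (real k) \<le> (SUP (u, v)\<in>?V \<times> ?V. ?d u v)"
    unfolding verts using n by (intro SUP_upper2[of "(0, x mod int n)"]) auto
qed

section \<open>Covering by the bowtie lattice\<close>

text \<open>
  In the next three lemmas \<open>a\<close>, \<open>c\<close> (and \<open>d\<close>, \<open>e\<close>) are the absolute values of the entries of
  \<open>r\<close> on the two outer vertices of a triangle and \<open>h\<close> that on the hub; \<open>p\<close>, \<open>q\<close>, \<open>t\<close> are the
  entries of \<open>A\<close> on the edges \<open>ac\<close>, \<open>ah\<close>, \<open>ch\<close> after the reflection that makes \<open>r\<close> nonnegative.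
  The final three alternatives below bound the cost of a move of the hub together with no other vertex,
  with \<open>a\<close>, and with \<open>c\<close>.
\<close>

lemma triangle_signs_hub_positive:
  fixes a b c p q t :: int
  assumes "a \<ge> 0" "c \<ge> 0" "b \<ge> 5" "p = 1 \<or> p = - 1" "q = 1 \<or> q = - 1" "t = 1 \<or> t = - 1"
    and "2 * b - 2 * a + \<bar>c - p\<bar> - c - q \<ge> 0" and "2 * b - 2 * c + \<bar>a + p\<bar> - a - t \<ge> 0"
  shows "\<exists>sa sc. (sa = 1 \<or> sa = - 1) \<and> (sc = 1 \<or> sc = - 1) \<and>
    (a > 0 \<longrightarrow> sa = 1 \<and> 2 * a \<le> 2 * b - p * sc - q) \<and>
    (c > 0 \<longrightarrow> sc = 1 \<and> 2 * c \<le> 2 * b + p * sa - t) \<and>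
    (\<bar>a + q\<bar> + \<bar>c + t\<bar> - a - c \<le> q * sa + t * sc \<or>
     2 * b - 2 * a + \<bar>c + t - p\<bar> - c \<le> q * sa + t * sc \<or>
     2 * b - 2 * c + \<bar>a + q + p\<bar> - a \<le> q * sa + t * sc)"
proof -
  consider "a > 0" "c > 0" | "a > 0" "c = 0" | "a = 0" "c > 0" | "a = 0" "c = 0"
    using assms(1,2) by linarith
  then show ?thesis
  proof cases
    case 1
    then show ?thesis using assms by (intro exI[of _ 1]) auto
  next
    case 2
    show ?thesis
    \<comment> \<open>The sign at the zero entry \<open>c\<close> is free. The choice
      \<open>t\<close> serves the hub best; if it violates the bound on \<open>a\<close>, then
      \<open>- t\<close> is taken and the move of the hub together with \<open>a\<close> is cheap
      enough.\<close>
    proof (cases "2 * a \<le> 2 * b - p * t - q")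
      case True
      then show ?thesis using assms 2 by (intro exI[of _ 1] exI[of _ t]) auto
    next
      case False
      then show ?thesis using assms 2 by (intro exI[of _ 1] exI[of _ "- t"]) auto
    qed
  next
    case 3
    show ?thesis
    proof (cases "2 * c \<le> 2 * b + p * q - t")
      case True
      then show ?thesis using assms 3 by (intro exI[of _ q] exI[of _ 1]) auto
    next
      case False
      then show ?thesis using assms 3 by (intro exI[of _ "- q"] exI[of _ 1]) auto
    qed
  next
    case 4
    then show ?thesis using assms by (intro exI[of _ q] exI[of _ t]) auto
  qed
qed

text \<open>A zero hub leaves its sign \<open>s\<close> free. If no outer signs fit
  \<open>s\<close>, the lemma names a blocking vertex: its edge to the hub carries \<open>s\<close>,
  and moving it costs at most -1 apart from the change at the hub.\<close>

lemma triangle_signs_hub_zero: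
  fixes a b c p q t s :: int
  assumes "a \<ge> 0" "c \<ge> 0" "b \<ge> 5" "p = 1 \<or> p = - 1" "q = 1 \<or> q = - 1" "t = 1 \<or> t = - 1"
    and "s = 1 \<or> s = - 1"
    and "2 * b - 2 * a + \<bar>c - p\<bar> - c + 1 \<ge> 0" and "2 * b - 2 * c + \<bar>a + p\<bar> - a + 1 \<ge> 0"
  shows "(\<exists>sa sc. (sa = 1 \<or> sa = - 1) \<and> (sc = 1 \<or> sc = - 1) \<and>
      (a > 0 \<longrightarrow> sa = 1 \<and> 2 * a \<le> 2 * b - p * sc - q * s) \<and>
      (c > 0 \<longrightarrow> sc = 1 \<and> 2 * c \<le> 2 * b + p * sa - t * s))
    \<or> q = s \<and> a > 0 \<and> 2 * b - 2 * a + \<bar>c - p\<bar> - c \<le> - 1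
    \<or> t = s \<and> c > 0 \<and> 2 * b - 2 * c + \<bar>a + p\<bar> - a \<le> - 1"
proof -
  consider "a > 0" "c > 0" | "a > 0" "c = 0" | "a = 0" "c > 0" | "a = 0" "c = 0"
    using assms(1,2) by linarith
  then show ?thesis
  proof cases
    case 1
    show ?thesis
    proof (cases "2 * a \<le> 2 * b - p - q * s")
      case a: True
      show ?thesis
      proof (cases "2 * c \<le> 2 * b + p - t * s")
        case True
        then show ?thesis using a assms 1 by (intro disjI1 exI[of _ 1]) auto
      next
        case False
        then have "t = s \<and> 2 * b - 2 * c + \<bar>a + p\<bar> - a \<le> - 1" using assms 1 by auto
        then show ?thesis using 1 by blast
      qed
    next
      case False
      then have "q = s \<and> 2 * b - 2 * a + \<bar>c - p\<bar> - c \<le> - 1" using assms 1 by auto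
      then show ?thesis using 1 by blast
    qed
  next
    case 2
    show ?thesis
    proof (cases "2 * a \<le> 2 * b + 1 - q * s")
      case True
      then show ?thesis using assms 2 by (intro disjI1 exI[of _ 1] exI[of _ "- p"]) auto
    next
      case False
      then have "q = s \<and> 2 * b - 2 * a + \<bar>c - p\<bar> - c \<le> - 1" using assms 2 by auto
      then show ?thesis using 2 by blast
    qed
  next
    case 3
    show ?thesis
    proof (cases "2 * c \<le> 2 * b + 1 - t * s")
      case True
      then show ?thesis using assms 3 by (intro disjI1 exI[of _ p] exI[of _ 1]) auto
    next
      case False
      then have "t = s \<and> 2 * b - 2 * c + \<bar>a + p\<bar> - a \<le> - 1" using assms 3 by auto
      then show ?thesis using 3 by blast
    qed
  next
    case 4
    then show ?thesis using assms by auto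
  qed
qed

lemma bowtie_signs_exist:
  fixes a c d e h b p q t p' q' t' :: int
  assumes b: "b \<ge> 5" and nonneg: "a \<ge> 0" "c \<ge> 0" "d \<ge> 0" "e \<ge> 0" "h \<ge> 0"
    and pqt: "p = 1 \<or> p = - 1" "q = 1 \<or> q = - 1" "t = 1 \<or> t = - 1"
    and pqt': "p' = 1 \<or> p' = - 1" "q' = 1 \<or> q' = - 1" "t' = 1 \<or> t' = - 1"
    and minimal: "\<And>A C D E H. a + c + d + e + h \<le>
      \<bar>a - 2 * b * A + p * C + q * H\<bar> + \<bar>c - p * A - 2 * b * C + t * H\<bar> +
      \<bar>d - 2 * b * D + p' * E + q' * H\<bar> + \<bar>e - p' * D - 2 * b * E + t' * H\<bar> +
      \<bar>h - q * A - t * C - q' * D - t' * E - 2 * b * H\<bar>"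
  shows "\<exists>sa sc sd se sh. sa \<in> {1, - 1} \<and> sc \<in> {1, - 1} \<and> sd \<in> {1, - 1} \<and> se \<in> {1, - 1} \<and> sh \<in> {1, - 1} \<and>
    (a > 0 \<longrightarrow> sa = 1 \<and> 2 * a \<le> 2 * b - p * sc - q * sh) \<and>
    (c > 0 \<longrightarrow> sc = 1 \<and> 2 * c \<le> 2 * b + p * sa - t * sh) \<and>
    (d > 0 \<longrightarrow> sd = 1 \<and> 2 * d \<le> 2 * b - p' * se - q' * sh) \<and>
    (e > 0 \<longrightarrow> se = 1 \<and> 2 * e \<le> 2 * b + p' * sd - t' * sh) \<and>
    (h > 0 \<longrightarrow> sh = 1 \<and> 2 * h \<le> 2 * b + q * sa + t * sc + q' * sd + t' * se)"
proof -
  note unit = pqt pqt'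
  have abs1: "- 1 \<le> p" "p \<le> 1" "- 1 \<le> q" "q \<le> 1" "- 1 \<le> t" "t \<le> 1"
      "- 1 \<le> p'" "p' \<le> 1" "- 1 \<le> q'" "q' \<le> 1" "- 1 \<le> t'" "t' \<le> 1"
    using unit by auto
  \<comment> \<open>Moves of a single vertex. Here and below the coefficients for
    \<open>minimal\<close> are listed in the order \<open>A\<close>, \<open>C\<close>,
    \<open>H\<close>, \<open>D\<close>, \<open>E\<close>.\<close>
  have a1: "a + c + h \<le> \<bar>a - 2 * b\<bar> + \<bar>c - p\<bar> + \<bar>h - q\<bar>"
    using minimal[of 1 0 0 0 0] nonneg by simp
  have c1: "a + c + h \<le> \<bar>a + p\<bar> + \<bar>c - 2 * b\<bar> + \<bar>h - t\<bar>"
    using minimal[of 0 1 0 0 0] nonneg by simp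
  have d1: "d + e + h \<le> \<bar>d - 2 * b\<bar> + \<bar>e - p'\<bar> + \<bar>h - q'\<bar>"
    using minimal[of 0 0 0 1 0] nonneg by simp
  have e1: "d + e + h \<le> \<bar>d + p'\<bar> + \<bar>e - 2 * b\<bar> + \<bar>h - t'\<bar>"
    using minimal[of 0 0 0 0 1] nonneg by simp
  have h1: "a + c + d + e + h \<le> \<bar>a + q\<bar> + \<bar>c + t\<bar> + \<bar>d + q'\<bar> + \<bar>e + t'\<bar> + \<bar>h - 2 * b\<bar>"
    using minimal[of 0 0 1 0 0] by simp
  \<comment> \<open>A move changes each neighbour by 1: two neighbours for an outer vertex, four for
    the hub, whence the slacks 2 and 4. The resulting bounds settle the signs inside the absolute
    values.\<close>
  have bound: "a \<le> b + 1" "c \<le> b + 1" "d \<le> b + 1" "e \<le> b + 1" "h \<le> b + 2"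
  proof -
    have near: "\<bar>x + y\<bar> \<le> x + 1" "\<bar>x - y\<bar> \<le> x + 1" if "x \<ge> 0" "- 1 \<le> y" "y \<le> 1" for x y :: int
      using that by auto
    have "a \<le> \<bar>a - 2 * b\<bar> + 2" using a1 near(2)[OF nonneg(2) abs1(1,2)] near(2)[OF nonneg(5) abs1(3,4)] by linarith
    moreover have "c \<le> \<bar>c - 2 * b\<bar> + 2" using c1 near(1)[OF nonneg(1) abs1(1,2)] near(2)[OF nonneg(5) abs1(5,6)] by linarith
    moreover have "d \<le> \<bar>d - 2 * b\<bar> + 2" using d1 near(2)[OF nonneg(4) abs1(7,8)] near(2)[OF nonneg(5) abs1(9,10)] by linarith
    moreover have "e \<le> \<bar>e - 2 * b\<bar> + 2" using e1 near(1)[OF nonneg(3) abs1(7,8)] near(2)[OF nonneg(5) abs1(11,12)] by linarith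
    moreover have "h \<le> \<bar>h - 2 * b\<bar> + 4"
      using h1 near(1)[OF nonneg(1) abs1(3,4)] near(1)[OF nonneg(2) abs1(5,6)] near(1)[OF nonneg(3) abs1(9,10)] near(1)[OF nonneg(4) abs1(11,12)] by linarith
    ultimately show "a \<le> b + 1" "c \<le> b + 1" "d \<le> b + 1" "e \<le> b + 1" "h \<le> b + 2"
      using b by (auto simp: abs_if split: if_splits)
  qed
  have far: "\<bar>a - 2 * b\<bar> = 2 * b - a" "\<bar>c - 2 * b\<bar> = 2 * b - c"
    "\<bar>d - 2 * b\<bar> = 2 * b - d" "\<bar>e - 2 * b\<bar> = 2 * b - e"
    using bound b by (simp_all add: abs_if)
  show ?thesis
  proof (cases "h = 0")
    case False
    then have h: "h > 0" using nonneg by simp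
    have "\<bar>h - q\<bar> = h - q" "\<bar>h - t\<bar> = h - t" "\<bar>h - q'\<bar> = h - q'" "\<bar>h - t'\<bar> = h - t'"
      using h abs1 by auto
    then have
      "2 * b - 2 * a + \<bar>c - p\<bar> - c - q \<ge> 0" "2 * b - 2 * c + \<bar>a + p\<bar> - a - t \<ge> 0"
      "2 * b - 2 * d + \<bar>e - p'\<bar> - e - q' \<ge> 0" "2 * b - 2 * e + \<bar>d + p'\<bar> - d - t' \<ge> 0"
      using a1 c1 d1 e1 unfolding far by simp_all
    note triangles =
      triangle_signs_hub_positive[OF nonneg(1,2) b pqt this(1,2)]
      triangle_signs_hub_positive[OF nonneg(3,4) b pqt' this(3,4)]
    from triangles(1) obtain sa sc where
      s: "sa = 1 \<or> sa = - 1" "sc = 1 \<or> sc = - 1"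
      and box: "a > 0 \<longrightarrow> sa = 1 \<and> 2 * a \<le> 2 * b - p * sc - q"
        "c > 0 \<longrightarrow> sc = 1 \<and> 2 * c \<le> 2 * b + p * sa - t"
      and ac: "\<bar>a + q\<bar> + \<bar>c + t\<bar> - a - c \<le> q * sa + t * sc \<or>
        2 * b - 2 * a + \<bar>c + t - p\<bar> - c \<le> q * sa + t * sc \<or>
        2 * b - 2 * c + \<bar>a + q + p\<bar> - a \<le> q * sa + t * sc"
      by (elim exE conjE) (rule that)
    from triangles(2) obtain sd se where
      s': "sd = 1 \<or> sd = - 1" "se = 1 \<or> se = - 1"
      and box': "d > 0 \<longrightarrow> sd = 1 \<and> 2 * d \<le> 2 * b - p' * se - q'"
        "e > 0 \<longrightarrow> se = 1 \<and> 2 * e \<le> 2 * b + p' * sd - t'"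
      and de: "\<bar>d + q'\<bar> + \<bar>e + t'\<bar> - d - e \<le> q' * sd + t' * se \<or>
        2 * b - 2 * d + \<bar>e + t' - p'\<bar> - e \<le> q' * sd + t' * se \<or>
        2 * b - 2 * e + \<bar>d + q' + p'\<bar> - d \<le> q' * sd + t' * se"
      by (elim exE conjE) (rule that)
    define X Y where "X = q * sa + t * sc" and "Y = q' * sd + t' * se"
    have abs_far: "\<bar>q + (a - 2 * b)\<bar> = 2 * b - a - q" "\<bar>t + (c - 2 * b)\<bar> = 2 * b - c - t"
      "\<bar>q' + (d - 2 * b)\<bar> = 2 * b - d - q'" "\<bar>t' + (e - 2 * b)\<bar> = 2 * b - e - t'"
      using bound b abs1 by (simp_all add: abs_if)
    \<comment> \<open>A hub move, joined by at most one outer vertex per triangle, where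
      \<open>u\<close> and \<open>u'\<close> are the costs of the triangles. The changes that the
      outer moves make at the hub cancel against the terms split off from \<open>u\<close> and
      \<open>u'\<close>.\<close>
    have hub: "2 * h \<le> 2 * b + u + u'"
      if "A = 0 \<and> C = 0 \<and> u = \<bar>a + q\<bar> + \<bar>c + t\<bar> - a - c \<or>
          A = 1 \<and> C = 0 \<and> u = 2 * b - 2 * a + \<bar>c + t - p\<bar> - c \<or>
          A = 0 \<and> C = 1 \<and> u = 2 * b - 2 * c + \<bar>a + q + p\<bar> - a"
        and "D = 0 \<and> E = 0 \<and> u' = \<bar>d + q'\<bar> + \<bar>e + t'\<bar> - d - e \<or>
          D = 1 \<and> E = 0 \<and> u' = 2 * b - 2 * d + \<bar>e + t' - p'\<bar> - e \<or>
          D = 0 \<and> E = 1 \<and> u' = 2 * b - 2 * e + \<bar>d + q' + p'\<bar> - d"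
      for A C D E u u' :: int
    proof -
      have "\<bar>a - 2 * b * A + p * C + q\<bar> + \<bar>c - p * A - 2 * b * C + t\<bar> = a + c + u - q * A - t * C"
        using that(1) abs_far(1,2) by (elim disjE conjE) (simp_all add: algebra_simps)
      moreover have "\<bar>d - 2 * b * D + p' * E + q'\<bar> + \<bar>e - p' * D - 2 * b * E + t'\<bar>
          = d + e + u' - q' * D - t' * E"
        using that(2) abs_far(3,4) by (elim disjE conjE) (simp_all add: algebra_simps)
      moreover have "\<bar>h - q * A - t * C - q' * D - t' * E - 2 * b\<bar>
          = 2 * b - h + q * A + t * C + q' * D + t' * E"
      proof -
        have "q * A + t * C \<in> {0, q, t}" using that(1) by (elim disjE conjE) simp_all
        moreover have "q' * D + t' * E \<in> {0, q', t'}" using that(2) by (elim disjE conjE) simp_all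
        ultimately have "- 1 \<le> q * A + t * C" "- 1 \<le> q' * D + t' * E" using abs1 by auto
        then show ?thesis using bound b by linarith
      qed
      ultimately have "a + c + d + e + h \<le> (a + c + u - q * A - t * C) + (d + e + u' - q' * D - t' * E)
          + (2 * b - h + q * A + t * C + q' * D + t' * E)"
        using minimal[of A C 1 D E] by (simp only: mult_1_right add.assoc)
      then show ?thesis by simp
    qed
    obtain A C u :: int where u: "A = 0 \<and> C = 0 \<and> u = \<bar>a + q\<bar> + \<bar>c + t\<bar> - a - c \<or>
          A = 1 \<and> C = 0 \<and> u = 2 * b - 2 * a + \<bar>c + t - p\<bar> - c \<or>
          A = 0 \<and> C = 1 \<and> u = 2 * b - 2 * c + \<bar>a + q + p\<bar> - a" "u \<le> X"
      using ac unfolding X_def by blast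
    obtain D E u' :: int where u': "D = 0 \<and> E = 0 \<and> u' = \<bar>d + q'\<bar> + \<bar>e + t'\<bar> - d - e \<or>
          D = 1 \<and> E = 0 \<and> u' = 2 * b - 2 * d + \<bar>e + t' - p'\<bar> - e \<or>
          D = 0 \<and> E = 1 \<and> u' = 2 * b - 2 * e + \<bar>d + q' + p'\<bar> - d" "u' \<le> Y"
      using de unfolding Y_def by blast
    have "2 * h \<le> 2 * b + X + Y" using hub[OF u(1) u'(1)] u(2) u'(2) by linarith
    then show ?thesis using s s' box box'
      by (intro exI[of _ sa] exI[of _ sc] exI[of _ sd] exI[of _ se] exI[of _ 1]) (simp add: X_def Y_def)
  next
    case h: True
    \<comment> \<open>Costs of the outer moves without the hub, which goes from 0 to distance 1;
      hence the summand 1 in \<open>single\<close>.\<close>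
    define Ea Ec Ed Ee where "Ea = 2 * b - 2 * a + \<bar>c - p\<bar> - c" and "Ec = 2 * b - 2 * c + \<bar>a + p\<bar> - a"
      and "Ed = 2 * b - 2 * d + \<bar>e - p'\<bar> - e" and "Ee = 2 * b - 2 * e + \<bar>d + p'\<bar> - d"
    note E_defs = Ea_def Ec_def Ed_def Ee_def
    have "\<bar>h - q\<bar> = 1" "\<bar>h - t\<bar> = 1" "\<bar>h - q'\<bar> = 1" "\<bar>h - t'\<bar> = 1"
      using h unit by auto
    then have single: "Ea + 1 \<ge> 0" "Ec + 1 \<ge> 0" "Ed + 1 \<ge> 0" "Ee + 1 \<ge> 0"
      using a1 c1 d1 e1 h unfolding E_defs far by simp_all
    \<comment> \<open>One vertex of each triangle moves, with opposite effects on the hub, so the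
      hub stays at 0 and no extra 1 arises. \<open>A\<close> selects \<open>a\<close> or
      \<open>c\<close>, and \<open>D\<close> selects \<open>d\<close> or \<open>e\<close>.\<close>
    have cross: "A = 0 \<or> A = 1 \<Longrightarrow> D = 0 \<or> D = 1 \<Longrightarrow>
        (if A = 1 then q else t) + (if D = 1 then q' else t') = 0 \<Longrightarrow>
        (if A = 1 then Ea else Ec) + (if D = 1 then Ed else Ee) \<ge> 0" for A D :: int
    proof -
      assume AD: "A = 0 \<or> A = 1" "D = 0 \<or> D = 1"
        and opp: "(if A = 1 then q else t) + (if D = 1 then q' else t') = 0"
      have "\<bar>a - 2 * b * A + p * (1 - A)\<bar> + \<bar>c - p * A - 2 * b * (1 - A)\<bar>
          = a + c + (if A = 1 then Ea else Ec)"
        using AD(1) far(1,2) unfolding E_defs by (elim disjE) simp_all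
      moreover have "\<bar>d - 2 * b * D + p' * (1 - D)\<bar> + \<bar>e - p' * D - 2 * b * (1 - D)\<bar>
          = d + e + (if D = 1 then Ed else Ee)"
        using AD(2) far(3,4) unfolding E_defs by (elim disjE) simp_all
      moreover have "h - q * A - t * (1 - A) - q' * D - t' * (1 - D) = 0"
        using AD opp h by (elim disjE) simp_all
      ultimately show ?thesis using minimal[of A "1 - A" 0 D "1 - D"] h by simp
    qed
    have same: "Ea + Ec \<ge> 0" if "a > 0" "c > 0" "q + t = 0"
    proof -
      have "\<bar>a - 2 * b + p\<bar> = 2 * b - a - p" "\<bar>c - p - 2 * b\<bar> = 2 * b - c + p"
        "\<bar>a + p\<bar> = a + p" "\<bar>c - p\<bar> = c - p"
        using bound b abs1 that by (simp_all add: abs_if)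
      then show ?thesis using minimal[of 1 1 0 0 0] h that nonneg unfolding E_defs by simp
    qed
    have same': "Ed + Ee \<ge> 0" if "d > 0" "e > 0" "q' + t' = 0"
    proof -
      have "\<bar>d - 2 * b + p'\<bar> = 2 * b - d - p'" "\<bar>e - p' - 2 * b\<bar> = 2 * b - e + p'"
        "\<bar>d + p'\<bar> = d + p'" "\<bar>e - p'\<bar> = e - p'"
        using bound b abs1 that by (simp_all add: abs_if)
      then show ?thesis using minimal[of 0 0 0 1 1] h that nonneg unfolding E_defs by simp
    qed
    define fit where "fit s \<longleftrightarrow> (\<exists>sa sc. (sa = 1 \<or> sa = - 1) \<and> (sc = 1 \<or> sc = - 1) \<and>
      (a > 0 \<longrightarrow> sa = 1 \<and> 2 * a \<le> 2 * b - p * sc - q * s) \<and>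
      (c > 0 \<longrightarrow> sc = 1 \<and> 2 * c \<le> 2 * b + p * sa - t * s))" for s
    define fit' where "fit' s \<longleftrightarrow> (\<exists>sd se. (sd = 1 \<or> sd = - 1) \<and> (se = 1 \<or> se = - 1) \<and>
      (d > 0 \<longrightarrow> sd = 1 \<and> 2 * d \<le> 2 * b - p' * se - q' * s) \<and>
      (e > 0 \<longrightarrow> se = 1 \<and> 2 * e \<le> 2 * b + p' * sd - t' * s))" for s
    have fit: "fit s \<or> q = s \<and> a > 0 \<and> Ea \<le> - 1 \<or> t = s \<and> c > 0 \<and> Ec \<le> - 1"
      if "s = 1 \<or> s = - 1" for s
      using triangle_signs_hub_zero[OF nonneg(1,2) b pqt that] single(1,2)
      unfolding fit_def Ea_def Ec_def by blast
    have fit': "fit' s \<or> q' = s \<and> d > 0 \<and> Ed \<le> - 1 \<or> t' = s \<and> e > 0 \<and> Ee \<le> - 1"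
      if "s = 1 \<or> s = - 1" for s
      using triangle_signs_hub_zero[OF nonneg(3,4) b pqt' that] single(3,4)
      unfolding fit'_def Ed_def Ee_def by blast
    have opposite: "q + q' = 0 \<Longrightarrow> Ea + Ed \<ge> 0" "q + t' = 0 \<Longrightarrow> Ea + Ee \<ge> 0"
      "t + q' = 0 \<Longrightarrow> Ec + Ed \<ge> 0" "t + t' = 0 \<Longrightarrow> Ec + Ee \<ge> 0"
      using cross[of 1 1] cross[of 1 0] cross[of 0 1] cross[of 0 0] by simp_all
    \<comment> \<open>If both hub signs failed, there would be a blocking vertex for each, with
      opposite edges to the hub. Moving both would change the norm by at most -2, against
      \<open>same\<close>, \<open>same'\<close> or \<open>opposite\<close>.\<close>
    have "(fit 1 \<and> fit' 1) \<or> (fit (- 1) \<and> fit' (- 1))"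
      using fit[of 1] fit[of "- 1"] fit'[of 1] fit'[of "- 1"] same same' opposite by (smt (verit))
    then obtain s where s: "s = 1 \<or> s = - 1" "fit s" "fit' s" by blast
    from s(2) obtain sa sc where ac: "sa = 1 \<or> sa = - 1" "sc = 1 \<or> sc = - 1"
      "a > 0 \<longrightarrow> sa = 1 \<and> 2 * a \<le> 2 * b - p * sc - q * s"
      "c > 0 \<longrightarrow> sc = 1 \<and> 2 * c \<le> 2 * b + p * sa - t * s"
      unfolding fit_def by (elim exE conjE) (rule that)
    from s(3) obtain sd se where de: "sd = 1 \<or> sd = - 1" "se = 1 \<or> se = - 1"
      "d > 0 \<longrightarrow> sd = 1 \<and> 2 * d \<le> 2 * b - p' * se - q' * s"
      "e > 0 \<longrightarrow> se = 1 \<and> 2 * e \<le> 2 * b + p' * sd - t' * s"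
      unfolding fit'_def by (elim exE conjE) (rule that)
    show ?thesis using s(1) ac de h
      by (intro exI[of _ sa] exI[of _ sc] exI[of _ sd] exI[of _ se] exI[of _ s]) simp
  qed
qed

text \<open>
  1-distance from \<open>(a, c, d, e, h)\<close> to the lattice vector with coefficient vector
  \<open>(z + 2 A, z + 2 C, z + 2 D, z + 2 E, z + 2 H)\<close>.
\<close>

definition bowtie_dist ::
  "int \<Rightarrow> int \<Rightarrow> int \<Rightarrow> int \<Rightarrow> int \<Rightarrow> int \<Rightarrow> int \<Rightarrow> int \<Rightarrow> int \<Rightarrow> int \<Rightarrow> int \<Rightarrow> int \<Rightarrow> int" where
  "bowtie_dist b a c d e h z A C D E H =
    \<bar>a - (b * z + 2 * b * A - C + H)\<bar> + \<bar>c - (b * z + A + 2 * b * C - H)\<bar> +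
    \<bar>d - (b * z + 2 * b * D - E + H)\<bar> + \<bar>e - (b * z + D + 2 * b * E - H)\<bar> +
    \<bar>h - (b * z - A + C - D + E + 2 * b * H)\<bar>"

lemma abs_unit_mult:
  fixes s y :: int
  assumes "s = 1 \<or> s = - 1"
  shows "\<bar>s * y\<bar> = \<bar>y\<bar>"
  using assms by auto

text \<open>A coordinate between 0 and that of \<open>v\<close> has distances to the two ends that
  add up to the absolute value of the latter. Everything is doubled to avoid halves, and the bound
  on \<open>w\<close> makes \<open>s\<close> the sign of \<open>2 * b * s + w\<close>.\<close>

lemma box_coordinate:
  fixes b r s w :: int
  assumes "r \<ge> 0" "s \<in> {1, - 1}" "\<bar>w\<bar> \<le> 2 * b" "r > 0 \<longrightarrow> s = 1 \<and> 2 * r \<le> 2 * b + w"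
  shows "2 * r + \<bar>2 * r - (2 * b * s + w)\<bar> = 2 * b + s * w"
proof (cases "r = 0")
  case True
  then show ?thesis using assms by auto
next
  case False
  then show ?thesis using assms by simp
qed

text \<open>The point found has \<open>z = 0\<close> (the nearest even point) or
  \<open>z = 1\<close> (that point shifted by the vector of the signs). Doubling allows for odd
  \<open>5 * b\<close>.\<close>

lemma bowtie_covering:
  fixes a b c d e h :: int
  assumes b: "b \<ge> 5"
  shows "\<exists>z A C D E H. 2 * bowtie_dist b a c d e h z A C D E H \<le> 5 * b"
proof -
  obtain A0 C0 D0 E0 H0 where least:
    "\<And>A C D E H. bowtie_dist b a c d e h 0 A0 C0 D0 E0 H0 \<le> bowtie_dist b a c d e h 0 A C D E H"
  proof -
    let ?f = "\<lambda>(A, C, D, E, H). nat (bowtie_dist b a c d e h 0 A C D E H)"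
    obtain T where "\<forall>T'. ?f T \<le> ?f T'" using ex_has_least_nat[of "\<lambda>_. True" _ ?f] by blast
    moreover obtain A0 C0 D0 E0 H0 where "T = (A0, C0, D0, E0, H0)" by (cases T)
    ultimately have min: "nat (bowtie_dist b a c d e h 0 A0 C0 D0 E0 H0) \<le> nat (bowtie_dist b a c d e h 0 A C D E H)"
      for A C D E H by auto
    show thesis
    proof (rule that)
      fix A C D E H
      have "bowtie_dist b a c d e h 0 A C D E H \<ge> 0" by (simp add: bowtie_dist_def)
      then show "bowtie_dist b a c d e h 0 A0 C0 D0 E0 H0 \<le> bowtie_dist b a c d e h 0 A C D E H"
        using min[of A C D E H] by linarith
    qed
  qed
  define ra rc rd re rh where
    "ra = a - (2 * b * A0 - C0 + H0)" and "rc = c - (A0 + 2 * b * C0 - H0)" and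
    "rd = d - (2 * b * D0 - E0 + H0)" and "re = e - (D0 + 2 * b * E0 - H0)" and
    "rh = h - (- A0 + C0 - D0 + E0 + 2 * b * H0)"
  have dist: "bowtie_dist b a c d e h z (A0 + A) (C0 + C) (D0 + D) (E0 + E) (H0 + H) =
      bowtie_dist b ra rc rd re rh z A C D E H" for z A C D E H
    unfolding bowtie_dist_def ra_def rc_def rd_def re_def rh_def by (simp add: algebra_simps)
  have minimal: "\<bar>ra\<bar> + \<bar>rc\<bar> + \<bar>rd\<bar> + \<bar>re\<bar> + \<bar>rh\<bar> \<le> bowtie_dist b ra rc rd re rh 0 A C D E H"
    for A C D E H
  proof -
    have "\<bar>ra\<bar> + \<bar>rc\<bar> + \<bar>rd\<bar> + \<bar>re\<bar> + \<bar>rh\<bar> = bowtie_dist b a c d e h 0 A0 C0 D0 E0 H0"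
      by (simp add: bowtie_dist_def ra_def rc_def rd_def re_def rh_def)
    then show ?thesis
      using least[of "A0 + A" "C0 + C" "D0 + D" "E0 + E" "H0 + H"] unfolding dist by simp
  qed
  \<comment> \<open>Zero gets sign 1, unlike with \<open>sgn\<close>, so that reflecting by
    \<open>sign\<close> is invertible at zero entries too.\<close>
  define sign where "sign x = (if x < 0 then - 1 else 1 :: int)" for x :: int
  have unit: "sign x = 1 \<or> sign x = - 1" for x by (simp add: sign_def)
  have abs_sign: "sign x * x = \<bar>x\<bar>" for x by (simp add: sign_def)
  have square: "sign x * (sign x * y) = y" for x y by (simp add: sign_def)
  define p q t where "p = sign ra * sign rc" and "q = - (sign ra * sign rh)" and "t = sign rc * sign rh"
  define p' q' t' where "p' = sign rd * sign re" and "q' = - (sign rd * sign rh)" and "t' = sign re * sign rh"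
  note pqt_defs = p_def q_def t_def p'_def q'_def t'_def
  have pqt: "p = 1 \<or> p = - 1" "q = 1 \<or> q = - 1" "t = 1 \<or> t = - 1"
    "p' = 1 \<or> p' = - 1" "q' = 1 \<or> q' = - 1" "t' = 1 \<or> t' = - 1"
    unfolding pqt_defs by (simp_all add: sign_def)
  have reflect: "\<bar>x - y\<bar> = \<bar>\<bar>x\<bar> - sign x * y\<bar>" for x y
    using abs_unit_mult[OF unit, of x "x - y"] by (simp add: right_diff_distrib abs_sign)
  have minimal': "\<bar>ra\<bar> + \<bar>rc\<bar> + \<bar>rd\<bar> + \<bar>re\<bar> + \<bar>rh\<bar> \<le>
      \<bar>\<bar>ra\<bar> - 2 * b * A + p * C + q * H\<bar> + \<bar>\<bar>rc\<bar> - p * A - 2 * b * C + t * H\<bar> +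
      \<bar>\<bar>rd\<bar> - 2 * b * D + p' * E + q' * H\<bar> + \<bar>\<bar>re\<bar> - p' * D - 2 * b * E + t' * H\<bar> +
      \<bar>\<bar>rh\<bar> - q * A - t * C - q' * D - t' * E - 2 * b * H\<bar>" for A C D E H
    \<comment> \<open>Reflecting the coefficients along with the coordinates permutes the even
      sublattice, so minimality carries over.\<close>
    using minimal[of "sign ra * A" "sign rc * C" "sign rd * D" "sign re * E" "sign rh * H"]
    unfolding bowtie_dist_def reflect[of ra] reflect[of rc] reflect[of rd] reflect[of re] reflect[of rh] pqt_defs
    by (simp add: algebra_simps square)
  obtain sa sc sd se sh where s: "sa \<in> {1, - 1}" "sc \<in> {1, - 1}" "sd \<in> {1, - 1}" "se \<in> {1, - 1}" "sh \<in> {1, - 1}"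
    and box: "\<bar>ra\<bar> > 0 \<longrightarrow> sa = 1 \<and> 2 * \<bar>ra\<bar> \<le> 2 * b - p * sc - q * sh"
      "\<bar>rc\<bar> > 0 \<longrightarrow> sc = 1 \<and> 2 * \<bar>rc\<bar> \<le> 2 * b + p * sa - t * sh"
      "\<bar>rd\<bar> > 0 \<longrightarrow> sd = 1 \<and> 2 * \<bar>rd\<bar> \<le> 2 * b - p' * se - q' * sh"
      "\<bar>re\<bar> > 0 \<longrightarrow> se = 1 \<and> 2 * \<bar>re\<bar> \<le> 2 * b + p' * sd - t' * sh"
      "\<bar>rh\<bar> > 0 \<longrightarrow> sh = 1 \<and> 2 * \<bar>rh\<bar> \<le> 2 * b + q * sa + t * sc + q' * sd + t' * se"
    using bowtie_signs_exist[OF b abs_ge_zero abs_ge_zero abs_ge_zero abs_ge_zero abs_ge_zero pqt minimal']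
    by (elim exE conjE) (rule that)
  \<comment> \<open>Undoing the reflection gives odd coefficients \<open>2 * A + 1\<close>, which is
    the form of a lattice vector with \<open>z = 1\<close>.\<close>
  have half: "\<exists>A. sign x * s = 2 * A + 1" if "s \<in> {1, - 1}" for x s
    using that unit[of x] by (auto intro: exI[of _ 0] exI[of _ "- 1"])
  obtain A C D E H where odd: "sign ra * sa = 2 * A + 1" "sign rc * sc = 2 * C + 1"
    "sign rd * sd = 2 * D + 1" "sign re * se = 2 * E + 1" "sign rh * sh = 2 * H + 1"
    using half[OF s(1)] half[OF s(2)] half[OF s(3)] half[OF s(4)] half[OF s(5)] by metis
  have twice: "2 * \<bar>x - v\<bar> = \<bar>2 * \<bar>x\<bar> - sign x * (2 * v)\<bar>" for x v
    using reflect[of x v] abs_mult[of 2 "\<bar>x\<bar> - sign x * v"] by (simp add: right_diff_distrib mult.left_commute)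
  have product: "\<bar>x * y\<bar> = 1" if "x = 1 \<or> x = - 1" "y \<in> {1, - 1}" for x y :: int
    using that by (auto simp: abs_mult)
  note size = product[OF pqt(1) s(1)] product[OF pqt(1) s(2)] product[OF pqt(2) s(1)] product[OF pqt(2) s(5)]
    product[OF pqt(3) s(2)] product[OF pqt(3) s(5)] product[OF pqt(4) s(3)] product[OF pqt(4) s(4)]
    product[OF pqt(5) s(3)] product[OF pqt(5) s(5)] product[OF pqt(6) s(4)] product[OF pqt(6) s(5)]
  have "2 * \<bar>ra\<bar> + 2 * \<bar>ra - (b + 2 * b * A - C + H)\<bar> = 2 * b + sa * (- p * sc - q * sh)"
  proof -
    have eq: "2 * (b + 2 * b * A - C + H) = 2 * b * (sign ra * sa) - sign rc * sc + sign rh * sh"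
      unfolding odd by (simp add: algebra_simps)
    have "sign ra * (2 * (b + 2 * b * A - C + H)) = 2 * b * sa + (- p * sc - q * sh)"
      unfolding eq pqt_defs by (simp add: algebra_simps square)
    moreover have "\<bar>- p * sc - q * sh\<bar> \<le> 2 * b" using size(2,4) b by linarith
    moreover have "\<bar>ra\<bar> > 0 \<longrightarrow> sa = 1 \<and> 2 * \<bar>ra\<bar> \<le> 2 * b + (- p * sc - q * sh)" using box(1) by (simp add: algebra_simps)
    ultimately show ?thesis
      using box_coordinate[OF abs_ge_zero s(1)] unfolding twice by metis
  qed
  moreover have "2 * \<bar>rc\<bar> + 2 * \<bar>rc - (b + A + 2 * b * C - H)\<bar> = 2 * b + sc * (p * sa - t * sh)"
  proof -
    have eq: "2 * (b + A + 2 * b * C - H) = 2 * b * (sign rc * sc) + sign ra * sa - sign rh * sh"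
      unfolding odd by (simp add: algebra_simps)
    have "sign rc * (2 * (b + A + 2 * b * C - H)) = 2 * b * sc + (p * sa - t * sh)"
      unfolding eq pqt_defs by (simp add: algebra_simps square)
    moreover have "\<bar>p * sa - t * sh\<bar> \<le> 2 * b" using size(1,6) b by linarith
    moreover have "\<bar>rc\<bar> > 0 \<longrightarrow> sc = 1 \<and> 2 * \<bar>rc\<bar> \<le> 2 * b + (p * sa - t * sh)" using box(2) by (simp add: algebra_simps)
    ultimately show ?thesis
      using box_coordinate[OF abs_ge_zero s(2)] unfolding twice by metis
  qed
  moreover have "2 * \<bar>rd\<bar> + 2 * \<bar>rd - (b + 2 * b * D - E + H)\<bar> = 2 * b + sd * (- p' * se - q' * sh)"
  proof -
    have eq: "2 * (b + 2 * b * D - E + H) = 2 * b * (sign rd * sd) - sign re * se + sign rh * sh"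
      unfolding odd by (simp add: algebra_simps)
    have "sign rd * (2 * (b + 2 * b * D - E + H)) = 2 * b * sd + (- p' * se - q' * sh)"
      unfolding eq pqt_defs by (simp add: algebra_simps square)
    moreover have "\<bar>- p' * se - q' * sh\<bar> \<le> 2 * b" using size(8,10) b by linarith
    moreover have "\<bar>rd\<bar> > 0 \<longrightarrow> sd = 1 \<and> 2 * \<bar>rd\<bar> \<le> 2 * b + (- p' * se - q' * sh)" using box(3) by (simp add: algebra_simps)
    ultimately show ?thesis
      using box_coordinate[OF abs_ge_zero s(3)] unfolding twice by metis
  qed
  moreover have "2 * \<bar>re\<bar> + 2 * \<bar>re - (b + D + 2 * b * E - H)\<bar> = 2 * b + se * (p' * sd - t' * sh)"
  proof -
    have eq: "2 * (b + D + 2 * b * E - H) = 2 * b * (sign re * se) + sign rd * sd - sign rh * sh"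
      unfolding odd by (simp add: algebra_simps)
    have "sign re * (2 * (b + D + 2 * b * E - H)) = 2 * b * se + (p' * sd - t' * sh)"
      unfolding eq pqt_defs by (simp add: algebra_simps square)
    moreover have "\<bar>p' * sd - t' * sh\<bar> \<le> 2 * b" using size(7,12) b by linarith
    moreover have "\<bar>re\<bar> > 0 \<longrightarrow> se = 1 \<and> 2 * \<bar>re\<bar> \<le> 2 * b + (p' * sd - t' * sh)" using box(4) by (simp add: algebra_simps)
    ultimately show ?thesis
      using box_coordinate[OF abs_ge_zero s(4)] unfolding twice by metis
  qed
  moreover have "2 * \<bar>rh\<bar> + 2 * \<bar>rh - (b - A + C - D + E + 2 * b * H)\<bar>
      = 2 * b + sh * (q * sa + t * sc + q' * sd + t' * se)"
  proof -
    have eq: "2 * (b - A + C - D + E + 2 * b * H)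
        = 2 * b * (sign rh * sh) - sign ra * sa + sign rc * sc - sign rd * sd + sign re * se"
      unfolding odd by (simp add: algebra_simps)
    have "sign rh * (2 * (b - A + C - D + E + 2 * b * H))
        = 2 * b * sh + (q * sa + t * sc + q' * sd + t' * se)"
      unfolding eq pqt_defs by (simp add: algebra_simps square)
    moreover have "\<bar>q * sa + t * sc + q' * sd + t' * se\<bar> \<le> 2 * b" using size(3,5,9,11) b by linarith
    moreover have "\<bar>rh\<bar> > 0 \<longrightarrow> sh = 1 \<and> 2 * \<bar>rh\<bar> \<le> 2 * b + (q * sa + t * sc + q' * sd + t' * se)" using box(5) by (simp add: algebra_simps)
    ultimately show ?thesis
      using box_coordinate[OF abs_ge_zero s(5)] unfolding twice by metis
  qed
  \<comment> \<open>Skew symmetry: each edge contributes twice with opposite signs. Only the five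
    terms \<open>2 * b\<close> survive in the sum of the two doubled norms.\<close>
  moreover have "sa * (- p * sc - q * sh) + sc * (p * sa - t * sh) + sd * (- p' * se - q' * sh)
      + se * (p' * sd - t' * sh) + sh * (q * sa + t * sc + q' * sd + t' * se) = 0"
    by (simp add: algebra_simps)
  ultimately have "2 * bowtie_dist b ra rc rd re rh 0 0 0 0 0 0 + 2 * bowtie_dist b ra rc rd re rh 1 A C D E H = 10 * b"
    unfolding bowtie_dist_def by simp
  then have "2 * bowtie_dist b ra rc rd re rh 0 0 0 0 0 0 \<le> 5 * b \<or> 2 * bowtie_dist b ra rc rd re rh 1 A C D E H \<le> 5 * b"
    by linarith
  then show ?thesis unfolding dist[symmetric] by blast
qed

section \<open>Minimum norm of the odd lattice points\<close>

text \<open>Pairing the doubled vector with the signs of its odd coefficients bounds its norm from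
  below. An edge loses at most the excess of its two coefficients over 1 in absolute value. Each
  vertex has degree at most 4, so the diagonal \<open>2 * b\<close> pays for this once
  \<open>b\<close> is at least 2.\<close>

lemma odd_bowtie_point_norm:
  fixes b :: int
  assumes b: "b \<ge> 2" and z: "odd z"
  shows "5 * b \<le> bowtie_dist b 0 0 0 0 0 z A C D E H"
proof -
  define ca cc cd ce ch where "ca = z + 2 * A" and "cc = z + 2 * C" and "cd = z + 2 * D"
    and "ce = z + 2 * E" and "ch = z + 2 * H"
  have odd: "\<bar>x\<bar> \<ge> 1" if "odd x" for x :: int using that by (cases "x = 0") auto
  have "odd ca" "odd cc" "odd cd" "odd ce" "odd ch"
    using z by (simp_all add: ca_def cc_def cd_def ce_def ch_def)
  then have ge1: "\<bar>ca\<bar> \<ge> 1" "\<bar>cc\<bar> \<ge> 1" "\<bar>cd\<bar> \<ge> 1" "\<bar>ce\<bar> \<ge> 1" "\<bar>ch\<bar> \<ge> 1"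
    by (blast intro: odd)+
  have coord: "2 * bowtie_dist b 0 0 0 0 0 z A C D E H =
      \<bar>2 * b * ca - cc + ch\<bar> + \<bar>ca + 2 * b * cc - ch\<bar> + \<bar>2 * b * cd - ce + ch\<bar> +
      \<bar>cd + 2 * b * ce - ch\<bar> + \<bar>2 * b * ch - ca + cc - cd + ce\<bar>"
  proof -
    have twice: "2 * \<bar>0 - x\<bar> = \<bar>y\<bar>" if "y = 2 * x" for x y :: int using that by simp
    show ?thesis unfolding bowtie_dist_def distrib_left
      by (intro arg_cong2[of _ _ _ _ "(+)"] twice)
        (simp_all add: ca_def cc_def cd_def ce_def ch_def algebra_simps)
  qed
  have sgn_le: "sgn x * y \<le> \<bar>y\<bar>" for x y :: int
    by (cases x "0 :: int" rule: linorder_cases) auto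
  have edge: "sgn x * y - sgn y * x \<ge> 2 - \<bar>x\<bar> - \<bar>y\<bar>" if "\<bar>x\<bar> \<ge> 1" "\<bar>y\<bar> \<ge> 1" for x y :: int
    using that by (auto simp: sgn_if)
  define na nc nd ne nh where "na = \<bar>ca\<bar>" and "nc = \<bar>cc\<bar>" and "nd = \<bar>cd\<bar>"
    and "ne = \<bar>ce\<bar>" and "nh = \<bar>ch\<bar>"
  note n_defs = na_def nc_def nd_def ne_def nh_def
  have edges: "sgn cc * ca - sgn ca * cc \<ge> 2 - nc - na" "sgn ca * ch - sgn ch * ca \<ge> 2 - na - nh"
    "sgn ch * cc - sgn cc * ch \<ge> 2 - nh - nc" "sgn ce * cd - sgn cd * ce \<ge> 2 - ne - nd"
    "sgn cd * ch - sgn ch * cd \<ge> 2 - nd - nh" "sgn ch * ce - sgn ce * ch \<ge> 2 - nh - ne"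
    unfolding n_defs using edge ge1 by blast+
  have slack: "(2 * b - 4) * (\<bar>x\<bar> - 1) \<ge> 0" if "\<bar>x\<bar> \<ge> 1" for x :: int
    using that b by simp
  have main: "2 * b * (na + nc + nd + ne + nh) \<ge> 10 * b + 4 * (na + nc + nd + ne + nh - 5)"
    using slack[OF ge1(1)] slack[OF ge1(2)] slack[OF ge1(3)] slack[OF ge1(4)] slack[OF ge1(5)]
    unfolding n_defs[symmetric] by (simp add: algebra_simps)
  have "2 * bowtie_dist b 0 0 0 0 0 z A C D E H \<ge>
      sgn ca * (2 * b * ca - cc + ch) + sgn cc * (ca + 2 * b * cc - ch) + sgn cd * (2 * b * cd - ce + ch) +
      sgn ce * (cd + 2 * b * ce - ch) + sgn ch * (2 * b * ch - ca + cc - cd + ce)"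
    unfolding coord by (intro add_mono sgn_le)
  moreover have "sgn ca * (2 * b * ca - cc + ch) + sgn cc * (ca + 2 * b * cc - ch) + sgn cd * (2 * b * cd - ce + ch) +
      sgn ce * (cd + 2 * b * ce - ch) + sgn ch * (2 * b * ch - ca + cc - cd + ce) =
      2 * b * (na + nc + nd + ne + nh)
      + (sgn cc * ca - sgn ca * cc) + (sgn ca * ch - sgn ch * ca) + (sgn ch * cc - sgn cc * ch)
      + (sgn ce * cd - sgn cd * ce) + (sgn cd * ch - sgn ch * cd) + (sgn ch * ce - sgn ce * ch)"
    unfolding n_defs by (simp add: abs_sgn algebra_simps)
  ultimately have "2 * bowtie_dist b 0 0 0 0 0 z A C D E H \<ge>
      (10 * b + 4 * (na + nc + nd + ne + nh - 5)) + (2 - nc - na) + (2 - na - nh) + (2 - nh - nc)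
      + (2 - ne - nd) + (2 - nd - nh) + (2 - nh - ne)"
    using add_mono[OF add_mono[OF add_mono[OF add_mono[OF add_mono[OF add_mono[OF
      main edges(1)] edges(2)] edges(3)] edges(4)] edges(5)] edges(6)] by simp
  then show ?thesis using ge1 unfolding n_defs[symmetric] by simp
qed

section \<open>The kernel lattice of the generators\<close>

text \<open>
  The order and the generators as polynomials in \<open>m\<close>, for \<open>k = 15 m + 12\<close>. The generators
  \<open>1\<close>, \<open>gen2\<close>, \<open>gen3\<close>, \<open>gen4\<close>, \<open>gen5\<close> belong to the coordinates \<open>a\<close>, \<open>d\<close>, \<open>c\<close>, \<open>h\<close>, \<open>e\<close>.
\<close>

definition circ_order :: "int \<Rightarrow> int" where
  "circ_order m = 124416 * m ^ 5 + 518400 * m ^ 4 + 869184 * m ^ 3 + 732960 * m ^ 2 + 310830 * m + 53025"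

definition gen2 :: "int \<Rightarrow> int" where
  "gen2 m = 10368 * m ^ 4 + 34560 * m ^ 3 + 43560 * m ^ 2 + 24600 * m + 5251"

definition gen3 :: "int \<Rightarrow> int" where
  "gen3 m = 41472 * m ^ 5 + 176256 * m ^ 4 + 300960 * m ^ 3 + 258168 * m ^ 2 + 111276 * m + 19281"

definition gen4 :: "int \<Rightarrow> int" where
  "gen4 m = 41472 * m ^ 5 + 176256 * m ^ 4 + 300960 * m ^ 3 + 258168 * m ^ 2 + 111288 * m + 19291"

definition gen5 :: "int \<Rightarrow> int" where
  "gen5 m = 41472 * m ^ 5 + 176256 * m ^ 4 + 301824 * m ^ 3 + 260328 * m ^ 2 + 113106 * m + 19806"

lemmas gen_defs = circ_order_def gen2_def gen3_def gen4_def gen5_def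

lemma bowtie_point_in_kernel:
  fixes m :: int
  assumes "b = 6 * m + 5"
  shows "(b * z + 2 * b * A - C + H) + (b * z + 2 * b * D - E + H) * gen2 m
    + (b * z + A + 2 * b * C - H) * gen3 m + (b * z - A + C - D + E + 2 * b * H) * gen4 m
    + (b * z + D + 2 * b * E - H) * gen5 m
    = circ_order m * ((6 * m + 6) * z + (4 * m + 4) * C + D + (4 * m + 4) * E + (4 * m + 3) * H)"
  unfolding assms gen_defs by algebra

text \<open>Converse of \<open>bowtie_point_in_kernel\<close>. The witnesses invert over the
  integers the linear map from \<open>(z, A, C, D, E)\<close> to the entries \<open>d\<close>,
  \<open>c\<close>, \<open>h\<close>, \<open>e\<close> and the quotient \<open>T\<close>; the entry
  \<open>a\<close> then follows from \<open>ker\<close>.\<close>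

lemma kernel_subset_bowtie_lattice:
  fixes m :: int
  assumes b: "b = 6 * m + 5"
    and ker: "a + d * gen2 m + c * gen3 m + h * gen4 m + e * gen5 m = circ_order m * T"
  shows "\<exists>z A C D E H. a = b * z + 2 * b * A - C + H \<and> d = b * z + 2 * b * D - E + H \<and>
    c = b * z + A + 2 * b * C - H \<and> h = b * z - A + C - D + E + 2 * b * H \<and>
    e = b * z + D + 2 * b * E - H"
proof (intro exI conjI)
  \<comment> \<open>Raising \<open>z\<close> by 2 and lowering the other five coefficients by 1
    fixes the lattice point, so \<open>H = 0\<close> can be imposed.\<close>
  let ?z = "(1728*m^3 + 4464*m^2 + 3852*m + 1111) * T - (144*m^2 + 252*m + 110) * d
    - (576*m^3 + 1536*m^2 + 1364*m + 404) * (c + h) - (576*m^3 + 1536*m^2 + 1376*m + 415) * e"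
  let ?A = "(10368*m^4 + 33696*m^3 + 41256*m^2 + 22554*m + 4645) * T - (864*m^3 + 2088*m^2 + 1692*m + 460) * d
    - (3456*m^4 + 11520*m^3 + 14424*m^2 + 8048*m + 1689) * (c + h) - h
    - (3456*m^4 + 11520*m^3 + 14496*m^2 + 8162*m + 1735) * e"
  let ?D = "- (864*m^3 + 2304*m^2 + 2046*m + 605) * T + (72*m^2 + 132*m + 60) * d
    + (288*m^3 + 792*m^2 + 724*m + 220) * (c + h) + (288*m^3 + 792*m^2 + 730*m + 226) * e"
  let ?C = "- (1728*m^3 + 4320*m^2 + 3624*m + 1020) * T + (144*m^2 + 240*m + 101) * d
    + (576*m^3 + 1488*m^2 + 1284*m + 371) * (c + h) + (576*m^3 + 1488*m^2 + 1296*m + 381) * e"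
  let ?E = "- (864*m^3 + 2160*m^2 + 1794*m + 495) * T + (72*m^2 + 120*m + 49) * d
    + (288*m^3 + 744*m^2 + 636*m + 180) * (c + h) + (288*m^3 + 744*m^2 + 642*m + 185) * e"
  have a: "a = circ_order m * T - d * gen2 m - c * gen3 m - h * gen4 m - e * gen5 m"
    using ker by simp
  show "a = b * ?z + 2 * b * ?A - ?C + 0" unfolding a b gen_defs by algebra
  show "d = b * ?z + 2 * b * ?D - ?E + 0" unfolding b by algebra
  show "c = b * ?z + ?A + 2 * b * ?C - 0" unfolding b by algebra
  show "h = b * ?z - ?A + ?C - ?D + ?E + 2 * b * 0" unfolding b by algebra
  show "e = b * ?z + ?D + 2 * b * ?E - 0" unfolding b by algebra
qed

text \<open>This makes the generators five distinct residues that are already reduced modulo the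
  order.\<close>

lemma gen_order:
  fixes m :: int
  assumes "m \<ge> 0"
  shows "1 < gen2 m" "gen2 m < gen3 m" "gen3 m < gen4 m" "gen4 m < gen5 m" "gen5 m < circ_order m"
proof -
  have nonneg: "0 \<le> m ^ 2" "0 \<le> m ^ 3" "0 \<le> m ^ 4" "0 \<le> m ^ 5" using assms by simp_all
  show "1 < gen2 m" "gen2 m < gen3 m" "gen3 m < gen4 m" "gen4 m < gen5 m" "gen5 m < circ_order m"
    unfolding gen_defs using nonneg assms by linarith+
qed

section \<open>The diameter and the theorem\<close>

lemma diameter_circulant:
  fixes m :: nat
  defines "S \<equiv> {1, gen2 (int m), gen3 (int m), gen4 (int m), gen5 (int m)}"
    and "n \<equiv> nat (circ_order (int m))"
  shows "graph_diameter (with_proj (circulant_graph n S)) = ereal (real (15 * m + 12))"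
proof -
  define M where "M = int m"
  define b where "b = 6 * M + 5"
  have M: "M \<ge> 0" by (simp add: M_def)
  have b5: "b \<ge> 5" using M by (simp add: b_def)
  note ord = gen_order[OF M]
  have n: "int n = circ_order M" "n > 0" using ord by (simp_all add: n_def M_def)
  have S: "S = {1, gen2 M, gen3 M, gen4 M, gen5 M}" by (simp add: S_def M_def)
  have neq: "1 \<noteq> gen2 M" "1 \<noteq> gen3 M" "1 \<noteq> gen4 M" "1 \<noteq> gen5 M"
    "gen2 M \<noteq> gen3 M" "gen2 M \<noteq> gen4 M" "gen2 M \<noteq> gen5 M" "gen3 M \<noteq> gen4 M" "gen3 M \<noteq> gen5 M" "gen4 M \<noteq> gen5 M"
    using ord by auto
  have sum_S: "(\<Sum>g\<in>S. f g) = f 1 + f (gen2 M) + f (gen3 M) + f (gen4 M) + f (gen5 M)" for f :: "int \<Rightarrow> int"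
    unfolding S using neq by (simp add: add.assoc)
  \<comment> \<open>The class of the point with \<open>a = d = b\<close>,
    \<open>c = 3 * M + 2\<close> and \<open>e = h = 0\<close>. Its norm is
    \<open>15 * M + 12\<close>, and its distance from the lattice point with all entries
    \<open>b\<close> is \<open>15 * M + 13\<close>.\<close>
  define X where "X = b + b * gen2 M + (3 * M + 2) * gen3 M"
  show ?thesis
  proof (rule graph_diameter_circulant_eqI)
    show "finite S" by (simp add: S)
    show "n > 0" by (rule n)
  next
    fix x :: int
    \<comment> \<open>Because 1 is a generator, \<open>(x, 0, 0, 0, 0)\<close> represents the class
      of \<open>x\<close>.\<close>
    obtain z A C D E H where dist: "2 * bowtie_dist b x 0 0 0 0 z A C D E H \<le> 5 * b"
      using bowtie_covering[OF b5] by blast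
    define y where "y = (\<lambda>_. 0)(1 := x - (b * z + 2 * b * A - C + H),
      gen2 M := - (b * z + 2 * b * D - E + H), gen3 M := - (b * z + A + 2 * b * C - H),
      gen4 M := - (b * z - A + C - D + E + 2 * b * H), gen5 M := - (b * z + D + 2 * b * E - H))"
    have y: "y 1 = x - (b * z + 2 * b * A - C + H)" "y (gen2 M) = - (b * z + 2 * b * D - E + H)"
      "y (gen3 M) = - (b * z + A + 2 * b * C - H)" "y (gen4 M) = - (b * z - A + C - D + E + 2 * b * H)"
      "y (gen5 M) = - (b * z + D + 2 * b * E - H)"
      unfolding y_def using neq by simp_all
    have "(\<Sum>g\<in>S. \<bar>y g\<bar>) = bowtie_dist b x 0 0 0 0 z A C D E H"
      unfolding sum_S y bowtie_dist_def by simp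
    then have "(\<Sum>g\<in>S. \<bar>y g\<bar>) \<le> int (15 * m + 12)" using dist by (simp add: b_def M_def)
    moreover have "x - (\<Sum>g\<in>S. y g * g)
        = circ_order M * ((6 * M + 6) * z + (4 * M + 4) * C + D + (4 * M + 4) * E + (4 * M + 3) * H)"
      using bowtie_point_in_kernel[OF b_def, of z A C H D E] unfolding sum_S y by (simp add: algebra_simps)
    then have "[x = (\<Sum>g\<in>S. y g * g)] (mod int n)" unfolding n cong_iff_dvd_diff by simp
    ultimately show "\<exists>y. (\<Sum>g\<in>S. \<bar>y g\<bar>) \<le> int (15 * m + 12) \<and> [x = (\<Sum>g\<in>S. y g * g)] (mod int n)"
      by blast
  next
    fix y :: "int \<Rightarrow> int"
    assume "[X = (\<Sum>g\<in>S. y g * g)] (mod int n)"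
    then obtain T where "X - (\<Sum>g\<in>S. y g * g) = circ_order M * T"
      unfolding cong_iff_dvd_diff n by (auto elim: dvdE)
    then have "(b - y 1) + (b - y (gen2 M)) * gen2 M + (3 * M + 2 - y (gen3 M)) * gen3 M
        + (- y (gen4 M)) * gen4 M + (- y (gen5 M)) * gen5 M = circ_order M * T"
      unfolding sum_S X_def by (simp add: algebra_simps)
    from kernel_subset_bowtie_lattice[OF b_def this] obtain z A C D E H where
      "b - y 1 = b * z + 2 * b * A - C + H" "b - y (gen2 M) = b * z + 2 * b * D - E + H"
      "3 * M + 2 - y (gen3 M) = b * z + A + 2 * b * C - H"
      "- y (gen4 M) = b * z - A + C - D + E + 2 * b * H" "- y (gen5 M) = b * z + D + 2 * b * E - H"
      by blast
    note point = this[symmetric]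
    show "int (15 * m + 12) \<le> (\<Sum>g\<in>S. \<bar>y g\<bar>)"
    \<comment> \<open>For odd \<open>z\<close>, \<open>y\<close> differs from the chosen point by an
      odd lattice vector. For even \<open>z\<close>, subtracting the all-\<open>b\<close> vector,
      which has \<open>z = 1\<close>, makes the difference odd. The triangle inequality then gives
      at least \<open>k + 1\<close> and \<open>k\<close> respectively.\<close>
    proof (cases "odd z")
      case True
      have "5 * b \<le> \<bar>b - y 1\<bar> + \<bar>3 * M + 2 - y (gen3 M)\<bar> + \<bar>b - y (gen2 M)\<bar> + \<bar>- y (gen5 M)\<bar> + \<bar>- y (gen4 M)\<bar>"
        using odd_bowtie_point_norm[OF _ True, of b A C D E H] b5
        unfolding bowtie_dist_def point by (simp add: abs_minus_commute)
      also have "\<dots> \<le> (b + \<bar>y 1\<bar>) + (3 * M + 2 + \<bar>y (gen3 M)\<bar>) + (b + \<bar>y (gen2 M)\<bar>)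
          + \<bar>y (gen5 M)\<bar> + \<bar>y (gen4 M)\<bar>"
        using M b5 by (intro add_mono) auto
      finally show ?thesis unfolding sum_S by (simp add: b_def M_def)
    next
      case False
      then have odd: "odd (z - 1)" by simp
      have "5 * b \<le> \<bar>- y 1\<bar> + \<bar>3 * M + 2 - b - y (gen3 M)\<bar> + \<bar>- y (gen2 M)\<bar> + \<bar>y (gen5 M) + b\<bar> + \<bar>y (gen4 M) + b\<bar>"
      proof -
        have "b * (z - 1) + 2 * b * A - C + H = - y 1"
          "b * (z - 1) + A + 2 * b * C - H = 3 * M + 2 - b - y (gen3 M)"
          "b * (z - 1) + 2 * b * D - E + H = - y (gen2 M)"
          "b * (z - 1) + D + 2 * b * E - H = - b - y (gen5 M)"
          "b * (z - 1) - A + C - D + E + 2 * b * H = - b - y (gen4 M)"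
          using point by (simp_all add: algebra_simps)
        note shifted = this
        show ?thesis
          using odd_bowtie_point_norm[OF _ odd, of b A C D E H] b5
          unfolding bowtie_dist_def shifted by (simp add: abs_minus_commute)
      qed
      also have "\<dots> \<le> \<bar>y 1\<bar> + (3 * M + 3 + \<bar>y (gen3 M)\<bar>) + \<bar>y (gen2 M)\<bar>
          + (b + \<bar>y (gen5 M)\<bar>) + (b + \<bar>y (gen4 M)\<bar>)"
        using M b5 by (intro add_mono) (auto simp: b_def)
      finally show ?thesis unfolding sum_S by (simp add: b_def M_def)
    qed
  qed
qed

theorem theorem7:
  fixes k :: nat
  assumes "k > 0" and "[k = 12] (mod 15)"
  shows "\<exists>n :: nat. of_nat n = L_CC_10 k \<and>
    (\<exists>S. S \<subseteq> {0..<int n} \<and> card S = 5 \<and>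
      graph_diameter (with_proj (circulant_graph n S)) = ereal (real k)) \<and>
    (\<exists>X :: int set. of_int ` X = generators_10 k \<and>
      card ((\<lambda>g. g mod int n) ` X) = 5 \<and>
      graph_diameter (with_proj (circulant_graph n X)) = ereal (real k))"
proof -
  have "k mod 15 = 12" using assms(2) by (simp add: cong_def)
  then obtain m where k: "k = 15 * m + 12" by (metis mult_div_mod_eq)
  define n where "n = nat (circ_order (int m))"
  define S where "S = {1, gen2 (int m), gen3 (int m), gen4 (int m), gen5 (int m)}"
  note ord = gen_order[of "int m", simplified]
  have n: "int n = circ_order (int m)" using ord by (simp add: n_def)
  have "(of_nat n :: rat) = of_int (int n)" by simp
  also have "\<dots> = L_CC_10 k"
    unfolding n circ_order_def L_CC_10_def k by (simp add: field_simps power_numeral_reduce)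
  finally have order: "of_nat n = L_CC_10 k" .
  have gens: "of_int ` S = generators_10 k"
    unfolding S_def generators_10_def k gen_defs image_insert image_empty
    by (intro arg_cong2[of _ _ _ _ insert] refl) (simp_all add: field_simps power_numeral_reduce)
  have range: "S \<subseteq> {0..<int n}" unfolding S_def n using ord by auto
  have card: "card S = 5" unfolding S_def using ord by simp
  \<comment> \<open>Reduction modulo \<open>n\<close> fixes \<open>S\<close>, so this one set
    witnesses both existence claims.\<close>
  have "(\<lambda>g. g mod int n) ` S = S" using range by (force simp: image_iff)
  moreover have "graph_diameter (with_proj (circulant_graph n S)) = ereal (real k)"
    unfolding n_def S_def k by (rule diameter_circulant)
  ultimately show ?thesis using order gens range card by metis
qed

end
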